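(* Let $K$ be a field, $\mathcal P$ a finite poset, and let $[A,B]$ and $[C,D]$ be spreads in $\mathcal P$. Denote by $X_1,\dots,X_n$ the connected components of $[A,B]\cap[C,D]$ which satisfy $$(\star)\qquad \{a\in A\mid a\le X_i\}\subseteq X_i\quad\text{and}\quad\{d\in D\mid X_i\le d\}\subseteq X_i.$$ Then there are inverse isomorphisms $\Phi:K^n\rightleftarrows\operatorname{Hom}(M_{[A,B]},M_{[C,D]}):\Psi$ given as follows. (i) Let $(\lambda_1,\dots,\lambda_n)\in K^n$, and identify each $\lambda_i$ with the linear map $K\to K$ given by scalar multiplication by $\lambda_i$. For each $x\in\mathcal P$ set $\Phi(\lambda_1,\dots,\lambda_n)_x=\lambda_i$ if $x\in X_i$ and $\Phi(\lambda_1,\dots,\lambda_n)_x=0$ if $x$ lies in no $X_i$. (ii) For each $i$, choose some $x_i\in X_i$. For $f\in\operatorname{Hom}(M_{[A,B]},M_{[C,D]})$ set $\Psi(f)=(f_{x_1}(1),\dots,f_{x_n}(1))$.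
   Context: For $X\subseteq\mathcal P$ and $a\in\mathcal P$, $a\le X$ (resp. $X\le a$) means there is $x\in X$ with $a\le x$ (resp. $x\le a$). For sets $A,B\subseteq\mathcal P$ of pairwise incomparable elements, $A\le B$ means $a\le B$ and $A\le b$ for all $a\in A$, $b\in B$; in that case the spread from $A$ to $B$ is $[A,B]=\{x\in\mathcal P\mid\exists a\in A,b\in B:\ a\le x\le b\}$. Connected components of a subset of $\mathcal P$ are taken with respect to unoriented paths inside the subset in the Hasse quiver of $\mathcal P$. Modules over the incidence algebra $I(\mathcal P)$ over $K$ (finitely generated) are identified with functors from $\mathcal P$ to finite-dimensional $K$-vector spaces, and $\operatorname{Hom}$ denotes the $K$-space of natural transformations $f=(f_x)_{x\in\mathcal P}$. The spread module $M_{[A,B]}$ has $M_{[A,B]}(p)=K$ if $p\in[A,B]$ and $0$ otherwise; for $p\le q$ the map $M_{[A,B]}(p)\to M_{[A,B]}(q)$ is $1_K$ if $p,q\in[A,B]$ and $0$ otherwise. *)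

theory Defs
  imports Complex_Main "HOL-Library.Function_Algebras"
begin

text \<open>
  A finite poset is a finite set \<open>P\<close> of elements of an ordered type, with the induced order.
\<close>

definition elem_le_set :: "'p::order \<Rightarrow> 'p set \<Rightarrow> bool" where
  "elem_le_set a X \<longleftrightarrow> (\<exists>x\<in>X. a \<le> x)"

definition set_le_elem :: "'p::order set \<Rightarrow> 'p \<Rightarrow> bool" where
  "set_le_elem X a \<longleftrightarrow> (\<exists>x\<in>X. x \<le> a)"

definition set_le_set :: "'p::order set \<Rightarrow> 'p set \<Rightarrow> bool" where
  "set_le_set A B \<longleftrightarrow> (\<forall>a\<in>A. elem_le_set a B) \<and> (\<forall>b\<in>B. set_le_elem A b)"

definition incomparable_set :: "'p::order set \<Rightarrow> bool" where
  "incomparable_set A \<longleftrightarrow> pairwise (\<lambda>x y. \<not> x \<le> y \<and> \<not> y \<le> x) A"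

definition spread_bounds :: "'p::order set \<Rightarrow> 'p set \<Rightarrow> 'p set \<Rightarrow> bool" where
  "spread_bounds P A B \<longleftrightarrow>
     A \<subseteq> P \<and> B \<subseteq> P \<and> incomparable_set A \<and> incomparable_set B \<and> set_le_set A B"

definition spread :: "'p::order set \<Rightarrow> 'p set \<Rightarrow> 'p set \<Rightarrow> 'p set" where
  "spread P A B = {x \<in> P. \<exists>a\<in>A. \<exists>b\<in>B. a \<le> x \<and> x \<le> b}"

definition hasse_arrow :: "'p::order set \<Rightarrow> 'p \<Rightarrow> 'p \<Rightarrow> bool" where
  "hasse_arrow P x y \<longleftrightarrow> x \<in> P \<and> y \<in> P \<and> x < y \<and> \<not> (\<exists>z\<in>P. x < z \<and> z < y)"

text \<open>
  The arrows are those of the Hasse quiver of the whole poset \<open>P\<close>; only the vertices of the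
  path have to lie in \<open>S\<close>.
\<close>

definition path_connected_in :: "'p::order set \<Rightarrow> 'p set \<Rightarrow> ('p \<times> 'p) set" where
  "path_connected_in P S =
     {(x, y) \<in> S \<times> S. (x, y) \<in> {(u, v) \<in> S \<times> S. hasse_arrow P u v \<or> hasse_arrow P v u}\<^sup>*}"

definition components_in :: "'p::order set \<Rightarrow> 'p set \<Rightarrow> 'p set set" where
  "components_in P S = S // path_connected_in P S"

definition star_condition :: "'p::order set \<Rightarrow> 'p set \<Rightarrow> 'p set \<Rightarrow> bool" where
  "star_condition A D X \<longleftrightarrow>
     {a \<in> A. elem_le_set a X} \<subseteq> X \<and> {d \<in> D. set_le_elem X d} \<subseteq> X"

text \<open>
  Vector spaces over a field \<open>'k\<close> are subspaces \<open>V\<close> of an ambient abelian group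
  with a scalar multiplication \<open>s\<close>.
\<close>

definition linear_on ::
  "('k::field \<Rightarrow> 'v::ab_group_add \<Rightarrow> 'v) \<Rightarrow> 'v set \<Rightarrow> ('k \<Rightarrow> 'w::ab_group_add \<Rightarrow> 'w) \<Rightarrow> 'w set \<Rightarrow>
     ('v \<Rightarrow> 'w) \<Rightarrow> bool" where
  "linear_on s V t W f \<longleftrightarrow>
     (\<forall>v\<in>V. f v \<in> W) \<and> (\<forall>u\<in>V. \<forall>v\<in>V. f (u + v) = f u + f v) \<and> (\<forall>c. \<forall>v\<in>V. f (s c v) = t c (f v))"

definition inverse_isomorphisms ::
  "('k::field \<Rightarrow> 'v::ab_group_add \<Rightarrow> 'v) \<Rightarrow> 'v set \<Rightarrow> ('k \<Rightarrow> 'w::ab_group_add \<Rightarrow> 'w) \<Rightarrow> 'w set \<Rightarrow>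
     ('v \<Rightarrow> 'w) \<Rightarrow> ('w \<Rightarrow> 'v) \<Rightarrow> bool" where
  "inverse_isomorphisms s V t W f g \<longleftrightarrow>
     linear_on s V t W f \<and> linear_on t W s V g \<and> (\<forall>v\<in>V. g (f v) = v) \<and> (\<forall>w\<in>W. f (g w) = w)"

text \<open>\<open>K\<^sup>n\<close>, with coordinates indexed by \<open>{1..n}\<close>, all others being \<open>0\<close>.\<close>

definition coord_space :: "nat \<Rightarrow> (nat \<Rightarrow> 'k::field) set" where
  "coord_space n = {l. \<forall>i. i \<notin> {1..n} \<longrightarrow> l i = 0}"

definition coord_scale :: "'k::field \<Rightarrow> (nat \<Rightarrow> 'k) \<Rightarrow> nat \<Rightarrow> 'k" where
  "coord_scale c l = (\<lambda>i. c * l i)"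

record ('p, 'k, 'v) poset_rep =
  scal :: "'k \<Rightarrow> 'v \<Rightarrow> 'v"
  stalk :: "'p \<Rightarrow> 'v set"
  transition :: "'p \<Rightarrow> 'p \<Rightarrow> 'v \<Rightarrow> 'v"

definition is_poset_rep ::
  "'p::order set \<Rightarrow> ('p, 'k::field, 'v::ab_group_add) poset_rep \<Rightarrow> bool" where
  "is_poset_rep P M \<longleftrightarrow>
     vector_space (scal M) \<and>
     (\<forall>p\<in>P. module.subspace (scal M) (stalk M p) \<and>
        (\<exists>b. finite b \<and> stalk M p = module.span (scal M) b)) \<and>
     (\<forall>p\<in>P. \<forall>q\<in>P. p \<le> q \<longrightarrow>
        linear_on (scal M) (stalk M p) (scal M) (stalk M q) (transition M p q)) \<and>
     (\<forall>p\<in>P. \<forall>v\<in>stalk M p. transition M p p v = v) \<and>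
     (\<forall>p\<in>P. \<forall>q\<in>P. \<forall>r\<in>P. p \<le> q \<longrightarrow> q \<le> r \<longrightarrow>
        (\<forall>v\<in>stalk M p. transition M q r (transition M p q v) = transition M p r v))"

text \<open>
  Natural transformations. HOL functions are total, so a family \<open>f\<close> is normalised to be \<open>0\<close>
  outside \<open>P\<close> and each \<open>f x\<close> to be \<open>0\<close> outside \<open>stalk M x\<close>; thus equality
  of families is equality of natural transformations, and the operations on \<open>Hom\<close> are pointwise.
\<close>

definition Hom ::
  "'p::order set \<Rightarrow> ('p, 'k::field, 'v::ab_group_add) poset_rep \<Rightarrow>
     ('p, 'k, 'w::ab_group_add) poset_rep \<Rightarrow> ('p \<Rightarrow> 'v \<Rightarrow> 'w) set" where
  "Hom P M N = {f.
     (\<forall>x\<in>P. linear_on (scal M) (stalk M x) (scal N) (stalk N x) (f x)) \<and>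
     (\<forall>x\<in>P. \<forall>y\<in>P. x \<le> y \<longrightarrow>
        (\<forall>v\<in>stalk M x. f y (transition M x y v) = transition N x y (f x v))) \<and>
     (\<forall>x v. x \<notin> P \<or> v \<notin> stalk M x \<longrightarrow> f x v = 0)}"

definition hom_scale ::
  "('p, 'k::field, 'w::ab_group_add) poset_rep \<Rightarrow> 'k \<Rightarrow> ('p \<Rightarrow> 'v \<Rightarrow> 'w) \<Rightarrow> 'p \<Rightarrow> 'v \<Rightarrow> 'w" where
  "hom_scale N c f = (\<lambda>x v. scal N c (f x v))"

definition spread_module :: "'p::order set \<Rightarrow> ('p, 'k::field, 'k) poset_rep" where
  "spread_module S =
     \<lparr>scal = (*),
      stalk = (\<lambda>p. if p \<in> S then UNIV else {0}),
      transition = (\<lambda>p q. if p \<in> S \<and> q \<in> S then (\<lambda>v. v) else (\<lambda>v. 0))\<rparr>"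

lemma vector_space_field: "vector_space ((*) :: 'k::field \<Rightarrow> 'k \<Rightarrow> 'k)"
  by unfold_locales (simp_all add: algebra_simps)

lemma vector_space_coord_scale: "vector_space (coord_scale :: 'k::field \<Rightarrow> _)"
  by unfold_locales (simp_all add: coord_scale_def fun_eq_iff algebra_simps)

lemma subspace_coord_space: "module.subspace coord_scale (coord_space n :: (nat \<Rightarrow> 'k::field) set)"
proof -
  interpret vector_space "coord_scale :: 'k \<Rightarrow> _" by (rule vector_space_coord_scale)
  show ?thesis by (auto simp: subspace_def coord_space_def coord_scale_def)
qed

lemma is_poset_rep_spread_module:
  "is_poset_rep P (spread_module (spread P A B) :: ('p::order, 'k::field, 'k) poset_rep)"
proof -
  interpret vector_space "(*) :: 'k \<Rightarrow> 'k \<Rightarrow> 'k" by (rule vector_space_field)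
  have 1: "span {1::'k} = UNIV"
    by (auto simp: span_singleton)
  have 2: "\<exists>b. finite b \<and> UNIV = span (b :: 'k set)" using 1 by (metis finite.intros)
  have 3: "\<exists>b. finite b \<and> {0} = span (b :: 'k set)" by (metis finite.emptyI span_empty)
  have 4: "q \<in> spread P A B"
    if "p \<in> spread P A B" "r \<in> spread P A B" "q \<in> P" "p \<le> q" "q \<le> r" for p q r
    using that unfolding spread_def by (auto intro: order_trans)
  let ?M = "spread_module (spread P A B) :: ('p, 'k, 'k) poset_rep"
  have scal: "scal ?M = (*)" by (simp add: spread_module_def)
  have fin: "subspace (stalk ?M p) \<and> (\<exists>b. finite b \<and> stalk ?M p = span b)" for p
    using 2 3 by (cases "p \<in> spread P A B") (simp_all add: spread_module_def subspace_def)
  have lin: "linear_on (*) (stalk ?M p) (*) (stalk ?M q) (transition ?M p q)" for p q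
    by (simp add: spread_module_def linear_on_def)
  have refl: "transition ?M p p v = v" if "v \<in> stalk ?M p" for p v
    using that by (simp add: spread_module_def split: if_splits)
  have comp: "transition ?M q r (transition ?M p q v) = transition ?M p r v"
    if "q \<in> P" "p \<le> q" "q \<le> r" for p q r v
    using 4[of p r q] that by (simp add: spread_module_def)
  show ?thesis
    unfolding is_poset_rep_def scal
    using vector_space_field fin lin refl comp by simp
qed

lemma vector_space_hom_scale:
  assumes "vector_space (scal N)"
  shows "vector_space (hom_scale N :: 'k::field \<Rightarrow> ('p::order \<Rightarrow> 'v \<Rightarrow> 'w::ab_group_add) \<Rightarrow> _)"
proof -
  interpret vector_space "scal N" by fact
  show ?thesis
    by unfold_locales
      (simp_all add: hom_scale_def fun_eq_iff scale_right_distrib scale_left_distrib)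
qed

lemma subspace_Hom:
  fixes M :: "('p::order, 'k::field, 'v::ab_group_add) poset_rep"
    and N :: "('p, 'k, 'w::ab_group_add) poset_rep"
  assumes M: "is_poset_rep P M" and N: "is_poset_rep P N"
  shows "module.subspace (hom_scale N) (Hom P M N)"
proof -
  interpret N: vector_space "scal N" using N by (simp add: is_poset_rep_def)
  interpret H: vector_space "hom_scale N :: 'k \<Rightarrow> ('p \<Rightarrow> 'v \<Rightarrow> 'w) \<Rightarrow> _"
    by (rule vector_space_hom_scale) unfold_locales
  have sub: "\<And>x. x \<in> P \<Longrightarrow> N.subspace (stalk N x)"
    and lin: "\<And>x y. x \<in> P \<Longrightarrow> y \<in> P \<Longrightarrow> x \<le> y \<Longrightarrow>
        linear_on (scal N) (stalk N x) (scal N) (stalk N y) (transition N x y)"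
    using N by (auto simp: is_poset_rep_def)
  have z: "transition N x y 0 = 0" if "x \<in> P" "y \<in> P" "x \<le> y" for x y
    using lin[OF that] N.subspace_0[OF sub[OF that(1)]]
    unfolding linear_on_def by (metis N.scale_zero_left)
  show ?thesis
    unfolding H.subspace_def
  proof (intro conjI ballI allI)
    show "0 \<in> Hom P M N"
      using sub z by (auto simp: Hom_def linear_on_def N.subspace_0)
  next
    fix f g assume "f \<in> Hom P M N" "g \<in> Hom P M N"
    then show "f + g \<in> Hom P M N"
      using sub lin by (auto simp: Hom_def linear_on_def N.subspace_add N.scale_right_distrib)
  next
    fix c f assume "f \<in> Hom P M N"
    then show "hom_scale N c f \<in> Hom P M N"
      using sub lin
      by (auto simp: Hom_def hom_scale_def linear_on_def N.subspace_scale N.scale_right_distrib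
          N.scale_left_commute)
  qed
qed

end

theory Submission imports Defs begin

text \<open>
  Write \<open>S\<close> and \<open>T\<close> for the two spreads. A linear map \<open>K \<rightarrow> K\<close> is multiplication by a scalar, so a
  morphism \<open>M\<^sub>S \<rightarrow> M\<^sub>T\<close> is a scalar function \<open>g\<close> on the poset vanishing off \<open>S \<inter> T\<close>, and all its
  naturality squares together say just that \<open>g p = g q\<close> whenever \<open>p \<le> q\<close>, \<open>p \<in> S\<close> and
  \<open>q \<in> T\<close> (\<open>Hom_spread_module_iff\<close>).

  Such a \<open>g\<close> is constant on each component of \<open>S \<inter> T\<close>, since it is constant along Hasse arrows.
  Condition \<open>(\<star>)\<close> decides whether the constant may be nonzero. If it fails for a component \<open>Z\<close>,
  then some \<open>a \<in> A\<close> below a point of \<open>Z\<close> lies in \<open>S\<close> but not in \<open>T\<close>, or some \<open>d \<in> D\<close> above a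
  point of \<open>Z\<close> lies in \<open>T\<close> but not in \<open>S\<close>; the function is \<open>0\<close> there, hence on \<open>Z\<close>
  (\<open>scalar_hom_vanishes\<close>). If it holds, no relation \<open>p \<le> q\<close> with \<open>p \<in> S\<close> and \<open>q \<in> T\<close> leaves or
  enters \<open>Z\<close>, so the indicator function of \<open>Z\<close> is itself a morphism (\<open>star_component_iff\<close>).
  Hence the indicator functions of the components satisfying \<open>(\<star>)\<close> form a basis of the space of
  morphisms, and evaluation at one point of each component reads off the coordinates.
\<close>

section \<open>Components of convex subsets\<close>

lemma spread_convex:
  assumes "x \<in> spread P A B" "z \<in> spread P A B" "y \<in> P" "x \<le> y" "y \<le> z"
  shows "y \<in> spread P A B"
  using assms unfolding spread_def by (auto intro: order_trans)

lemma lower_bounds_in_spread: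
  assumes "spread_bounds P A B"
  shows "A \<subseteq> spread P A B"
  using assms unfolding spread_bounds_def set_le_set_def elem_le_set_def spread_def by fast

lemma upper_bounds_in_spread:
  assumes "spread_bounds P A B"
  shows "B \<subseteq> spread P A B"
  using assms unfolding spread_bounds_def set_le_set_def set_le_elem_def spread_def by fast

lemma equiv_path_connected_in: "equiv S (path_connected_in P S)"
proof -
  let ?E = "{(u, v) \<in> S \<times> S. hasse_arrow P u v \<or> hasse_arrow P v u}"
  have "sym (?E\<^sup>*)"
    by (rule sym_rtrancl) (auto simp: sym_def)
  then show ?thesis
    unfolding path_connected_in_def
    by (auto intro!: equivI refl_onI symI transI dest: symD intro: rtrancl_trans)
qed

text \<open>
  A saturated chain from \<open>x\<close> to \<open>y\<close> stays inside \<open>S\<close> by convexity; finiteness of \<open>P\<close> provides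
  such a chain, here by repeated splitting of the interval between \<open>x\<close> and \<open>y\<close>.
\<close>

lemma comparable_path_connected:
  assumes P: "finite P" and "S \<subseteq> P"
    and conv: "\<And>x y z. x \<in> S \<Longrightarrow> z \<in> S \<Longrightarrow> y \<in> P \<Longrightarrow> x \<le> y \<Longrightarrow> y \<le> z \<Longrightarrow> y \<in> S"
  shows "x \<in> S \<Longrightarrow> y \<in> S \<Longrightarrow> x \<le> y \<Longrightarrow> (x, y) \<in> path_connected_in P S"
proof (induction "card {z \<in> P. x \<le> z \<and> z \<le> y}" arbitrary: x y rule: less_induct)
  case less
  note eq = equiv_path_connected_in[of S P]
  consider "x = y" | "hasse_arrow P x y" | z where "z \<in> P" "x < z" "z < y"
    using less.prems \<open>S \<subseteq> P\<close> unfolding hasse_arrow_def by force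
  then show ?case
  proof cases
    case 1
    then show ?thesis
      using eq less.prems(1) by (simp add: equiv_class_eq_iff)
  next
    case 2
    then show ?thesis
      using less.prems unfolding path_connected_in_def by (auto intro!: r_into_rtrancl)
  next
    case 3
    then have "z \<in> S"
      using conv less.prems by (meson less_imp_le)
    have "{w \<in> P. x \<le> w \<and> w \<le> z} \<subset> {w \<in> P. x \<le> w \<and> w \<le> y}"
      using 3 less.prems \<open>S \<subseteq> P\<close> by (auto dest: leD)
    then have "(x, z) \<in> path_connected_in P S"
      using 3 less.hyps less.prems \<open>z \<in> S\<close> P by (simp add: psubset_card_mono)
    moreover have "{w \<in> P. z \<le> w \<and> w \<le> y} \<subset> {w \<in> P. x \<le> w \<and> w \<le> y}"
      using 3 less.prems \<open>S \<subseteq> P\<close> by (auto dest: leD)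
    then have "(z, y) \<in> path_connected_in P S"
      using 3 less.hyps less.prems \<open>z \<in> S\<close> P by (simp add: psubset_card_mono)
    ultimately show ?thesis
      using eq by (meson equiv_def transD)
  qed
qed

lemma component_subset: "Z \<in> components_in P S \<Longrightarrow> Z \<subseteq> S"
  unfolding components_in_def using equiv_path_connected_in[of S P]
  by (metis Sup_upper Union_quotient)

lemma component_closed_comparable:
  assumes "finite P" and Z: "Z \<in> components_in P (spread P A B \<inter> spread P C D)"
    and "p \<in> spread P A B \<inter> spread P C D" "q \<in> spread P A B \<inter> spread P C D" "p \<le> q"
  shows "p \<in> Z \<longleftrightarrow> q \<in> Z"
proof -
  let ?S = "spread P A B \<inter> spread P C D"
  have "(p, q) \<in> path_connected_in P ?S"
  proof (rule comparable_path_connected[OF \<open>finite P\<close>])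
    show "?S \<subseteq> P"
      by (auto simp: spread_def)
    show "y \<in> ?S" if "x \<in> ?S" "z \<in> ?S" "y \<in> P" "x \<le> y" "y \<le> z" for x y z
      using that spread_convex[of x P _ _ z y] by blast
  qed (use assms in auto)
  then show ?thesis
    using Z equiv_path_connected_in[of ?S P] unfolding components_in_def
    by (meson in_quotient_imp_closed equivE symE)
qed

text \<open>
  An upper bound \<open>d\<close> of \<open>q\<close> is above \<open>p\<close>, so \<open>(\<star>)\<close> puts it into \<open>Z\<close>, and then \<open>q\<close> is
  squeezed between \<open>p\<close> and \<open>d\<close> inside \<open>spread P A B\<close>; dually for a lower bound of \<open>p\<close>.
\<close>

lemma star_component_iff:
  assumes "finite P"
    and Z: "Z \<in> components_in P (spread P A B \<inter> spread P C D)" and star: "star_condition A D Z"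
    and p: "p \<in> spread P A B" and q: "q \<in> spread P C D" and "p \<le> q"
  shows "p \<in> Z \<longleftrightarrow> q \<in> Z"
proof
  assume pZ: "p \<in> Z"
  obtain d where d: "d \<in> D" "q \<le> d"
    using q unfolding spread_def by auto
  then have "d \<in> Z"
    using star pZ \<open>p \<le> q\<close> unfolding star_condition_def set_le_elem_def
    by (blast intro: order_trans)
  then have "q \<in> spread P A B"
    using spread_convex[OF p _ _ \<open>p \<le> q\<close> d(2)] component_subset[OF Z] q
    by (auto simp: spread_def)
  then show "q \<in> Z"
    using component_closed_comparable[OF assms(1) Z _ _ \<open>p \<le> q\<close>] component_subset[OF Z] pZ q
    by blast
next
  assume qZ: "q \<in> Z"
  obtain a where a: "a \<in> A" "a \<le> p"
    using p unfolding spread_def by auto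
  then have "a \<in> Z"
    using star qZ \<open>p \<le> q\<close> unfolding star_condition_def elem_le_set_def
    by (blast intro: order_trans)
  then have "p \<in> spread P C D"
    using spread_convex[OF _ q _ a(2) \<open>p \<le> q\<close>] component_subset[OF Z] p
    by (auto simp: spread_def)
  then show "p \<in> Z"
    using component_closed_comparable[OF assms(1) Z _ _ \<open>p \<le> q\<close>] component_subset[OF Z] qZ p
    by blast
qed

section \<open>Morphisms as scalar functions\<close>

definition scalar_hom :: "'p::order set \<Rightarrow> 'p set \<Rightarrow> ('p \<Rightarrow> 'k::field) \<Rightarrow> bool" where
  "scalar_hom S T g \<longleftrightarrow>
     (\<forall>y. y \<notin> S \<inter> T \<longrightarrow> g y = 0) \<and> (\<forall>p\<in>S. \<forall>q\<in>T. p \<le> q \<longrightarrow> g p = g q)"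

text \<open>
  The square of \<open>p \<le> q\<close> is void unless \<open>p \<in> S\<close> and \<open>q \<in> T\<close>: otherwise its source or its target
  is \<open>0\<close>. In the remaining case it reads \<open>g q = g p\<close>. This includes \<open>q \<notin> S\<close>, where \<open>g q\<close> and the
  transition map of \<open>S\<close> are both \<open>0\<close>, and \<open>p \<notin> T\<close>, where the same holds for \<open>g p\<close> and \<open>T\<close>.
\<close>

lemma Hom_spread_module_iff:
  fixes f :: "'p::order \<Rightarrow> 'k::field \<Rightarrow> 'k"
  assumes "S \<subseteq> P" "T \<subseteq> P"
  shows "f \<in> Hom P (spread_module S) (spread_module T) \<longleftrightarrow>
    (\<exists>g. scalar_hom S T g \<and> f = (\<lambda>y v. g y * v))"
proof
  assume f: "f \<in> Hom P (spread_module S) (spread_module T)"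
  define g where "g = (\<lambda>y. f y 1)"
  have lin: "f y v \<in> (if y \<in> T then UNIV else {0}) \<and> f y (c * v) = c * f y v"
    if "y \<in> P" "v \<in> (if y \<in> S then UNIV else {0})" for y c v
    using f that unfolding Hom_def linear_on_def spread_module_def by simp
  have square: "f q (if q \<in> S then 1 else 0) = (if p \<in> T then f p 1 else 0)"
    if "p \<in> S" "q \<in> T" "p \<le> q" for p q
  proof -
    have "p \<in> P" "q \<in> P"
      using that assms by auto
    then have "\<forall>v\<in>stalk (spread_module S) p. f q (transition (spread_module S) p q v) =
        transition (spread_module T) p q (f p v)"
      using f that(3) unfolding Hom_def by blast
    then show ?thesis
      using that(1,2) by (auto simp: spread_module_def)
  qed
  have off: "f y v = 0" if "y \<notin> S" for y v
  proof (cases "v = 0 \<and> y \<in> P")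
    case True
    then show ?thesis
      using lin[of y 0 0] that by simp
  next
    case False
    then show ?thesis
      using f that unfolding Hom_def spread_module_def by auto
  qed
  have fg: "f y v = g y * v" for y v
    using lin[of y 1 v] off[of y] \<open>S \<subseteq> P\<close> by (cases "y \<in> S") (auto simp: g_def)
  have zero: "g y = 0" if "y \<notin> S \<inter> T" for y
    using lin[of y 1] off[of y] that \<open>S \<subseteq> P\<close> by (cases "y \<in> S") (auto simp: g_def)
  have "g p = g q" if "p \<in> S" "q \<in> T" "p \<le> q" for p q
    using square[OF that] zero[of p] zero[of q] by (auto simp: fg split: if_splits)
  then show "\<exists>g. scalar_hom S T g \<and> f = (\<lambda>y v. g y * v)"
    using zero fg unfolding scalar_hom_def by blast
next
  assume "\<exists>g. scalar_hom S T g \<and> f = (\<lambda>y v. g y * v)"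
  then obtain g where g: "scalar_hom S T g" and f: "f = (\<lambda>y v. g y * v)"
    by blast
  have off: "g y = 0" if "y \<notin> S \<or> y \<notin> T" for y
    using g that unfolding scalar_hom_def by auto
  have nat: "g p = g q" if "p \<in> S" "q \<in> T" "p \<le> q" for p q
    using g that unfolding scalar_hom_def by auto
  have "linear_on (*) (stalk (spread_module S) y) (*) (stalk (spread_module T) y) (f y)" for y
    using off[of y] by (auto simp: linear_on_def f spread_module_def algebra_simps)
  moreover have "f q (transition (spread_module S) p q v) =
      transition (spread_module T) p q (f p v)"
    if "p \<le> q" "v \<in> stalk (spread_module S) p" for p q v
    using nat[of p q] off[of p] off[of q] that
    by (cases "q \<in> T") (auto simp: f spread_module_def split: if_splits)
  moreover have "f y v = 0" if "y \<notin> P \<or> v \<notin> stalk (spread_module S) y" for y v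
    using off[of y] that \<open>S \<subseteq> P\<close> by (auto simp: f spread_module_def split: if_splits)
  ultimately show "f \<in> Hom P (spread_module S) (spread_module T)"
    unfolding Hom_def by (simp add: spread_module_def)
qed

lemma scalar_hom_constant_on_component:
  assumes g: "scalar_hom S T g"
    and Z: "Z \<in> components_in P (S \<inter> T)" "y \<in> Z" "z \<in> Z"
  shows "g y = g z"
proof -
  let ?E = "{(u, v) \<in> (S \<inter> T) \<times> (S \<inter> T). hasse_arrow P u v \<or> hasse_arrow P v u}"
  have "(y, z) \<in> path_connected_in P (S \<inter> T)"
    using in_quotient_imp_in_rel[OF equiv_path_connected_in Z(1)[unfolded components_in_def]] Z(2,3)
    by simp
  then have "(y, z) \<in> ?E\<^sup>*"
    by (simp add: path_connected_in_def)
  then show ?thesis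
  proof induction
    case (step u v)
    then have "u \<in> S \<inter> T" "v \<in> S \<inter> T" "u \<le> v \<or> v \<le> u"
      unfolding hasse_arrow_def by auto
    then have "g u = g v"
      using g unfolding scalar_hom_def by (metis IntD1 IntD2)
    then show ?case
      using step.IH by simp
  qed simp
qed

text \<open>
  A point of \<open>A\<close> below \<open>Z\<close> but outside \<open>Z\<close> cannot lie in \<open>spread P C D\<close>, for it would then belong
  to the component \<open>Z\<close>. So \<open>g\<close> is \<open>0\<close> at that point, hence also at the point of \<open>Z\<close> above it.
  The argument for \<open>D\<close> is dual.
\<close>

lemma scalar_hom_vanishes:
  assumes P: "finite P" and AB: "spread_bounds P A B" and CD: "spread_bounds P C D"
    and g: "scalar_hom (spread P A B) (spread P C D) g"
    and Z: "Z \<in> components_in P (spread P A B \<inter> spread P C D)" "\<not> star_condition A D Z" "y \<in> Z"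
  shows "g y = 0"
proof -
  note sub = component_subset[OF Z(1)] and closed = component_closed_comparable[OF P Z(1)]
  have zero: "g w = 0" if "w \<notin> spread P A B \<or> w \<notin> spread P C D" for w
    using g that unfolding scalar_hom_def by auto
  have nat: "g p = g q" if "p \<in> spread P A B" "q \<in> spread P C D" "p \<le> q" for p q
    using g that unfolding scalar_hom_def by auto
  consider a z where "a \<in> A" "z \<in> Z" "a \<le> z" "a \<notin> Z"
    | d z where "d \<in> D" "z \<in> Z" "z \<le> d" "d \<notin> Z"
    using Z(2) unfolding star_condition_def elem_le_set_def set_le_elem_def by blast
  then have "\<exists>z\<in>Z. g z = 0"
  proof cases
    case 1
    moreover have "a \<in> spread P A B"
      using 1 lower_bounds_in_spread[OF AB] by blast
    ultimately show ?thesis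
      using closed[of a z] nat[of a z] zero[of a] sub by (metis IntD2 IntI subsetD)
  next
    case 2
    moreover have "d \<in> spread P C D"
      using 2 upper_bounds_in_spread[OF CD] by blast
    ultimately show ?thesis
      using closed[of z d] nat[of z d] zero[of d] sub by (metis IntD1 IntI subsetD)
  qed
  then show ?thesis
    using scalar_hom_constant_on_component[OF g Z(1,3)] by metis
qed

section \<open>The isomorphism\<close>

theorem proposition5p5:
  fixes P A B C D :: "'p::order set"
    and n :: nat
    and X :: "nat \<Rightarrow> 'p set"
    and x :: "nat \<Rightarrow> 'p"
  assumes "finite P"
    and "spread_bounds P A B"
    and "spread_bounds P C D"
    and "bij_betw X {1..n}
           {Z \<in> components_in P (spread P A B \<inter> spread P C D). star_condition A D Z}"
    and "\<forall>i\<in>{1..n}. x i \<in> X i"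
  shows "\<exists>(\<Phi> :: (nat \<Rightarrow> 'k::field) \<Rightarrow> ('p \<Rightarrow> 'k \<Rightarrow> 'k)) (\<Psi> :: ('p \<Rightarrow> 'k \<Rightarrow> 'k) \<Rightarrow> (nat \<Rightarrow> 'k)).
    inverse_isomorphisms
      coord_scale (coord_space n)
      (hom_scale (spread_module (spread P C D)))
      (Hom P (spread_module (spread P A B)) (spread_module (spread P C D)))
      \<Phi> \<Psi> \<and>
    (\<forall>l\<in>coord_space n.
       (\<forall>i\<in>{1..n}. \<forall>y\<in>X i. \<Phi> l y = (\<lambda>v. l i * v)) \<and>
       (\<forall>y. y \<notin> (\<Union>i\<in>{1..n}. X i) \<longrightarrow> \<Phi> l y = (\<lambda>v. 0))) \<and>
    (\<forall>f\<in>Hom P (spread_module (spread P A B)) (spread_module (spread P C D)).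
       \<Psi> f = (\<lambda>i. if i \<in> {1..n} then f (x i) 1 else 0))"
proof -
  define S where "S = spread P A B"
  define T where "T = spread P C D"
  have SP: "S \<subseteq> P" "T \<subseteq> P"
    by (auto simp: S_def T_def spread_def)
  have X: "X i \<in> components_in P (S \<inter> T)" "star_condition A D (X i)" "x i \<in> X i"
    if "i \<in> {1..n}" for i
    using bij_betw_apply[OF assms(4) that] assms(5) that unfolding S_def T_def by simp_all
  have disjoint: "i = j" if "i \<in> {1..n}" "j \<in> {1..n}" "y \<in> X i" "y \<in> X j" for i j y
  proof -
    have "X i = X j"
      using quotient_disj[OF equiv_path_connected_in X(1)[OF that(1), unfolded components_in_def]
          X(1)[OF that(2), unfolded components_in_def]] that(3,4) by blast
    then show ?thesis
      using assms(4) that(1,2) by (meson bij_betw_imp_inj_on inj_onD)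
  qed
  \<comment> \<open>Summing over all indices makes \<open>\<phi>\<close> visibly linear; by disjointness at most one
    summand is nonzero.\<close>
  define \<phi> :: "(nat \<Rightarrow> 'k) \<Rightarrow> 'p \<Rightarrow> 'k"
    where "\<phi> = (\<lambda>l y. \<Sum>i\<in>{1..n}. if y \<in> X i then l i else 0)"
  define \<Phi> :: "(nat \<Rightarrow> 'k) \<Rightarrow> 'p \<Rightarrow> 'k \<Rightarrow> 'k" where "\<Phi> = (\<lambda>l y v. \<phi> l y * v)"
  define \<Psi> :: "('p \<Rightarrow> 'k \<Rightarrow> 'k) \<Rightarrow> nat \<Rightarrow> 'k"
    where "\<Psi> = (\<lambda>f i. if i \<in> {1..n} then f (x i) 1 else 0)"
  let ?H = "Hom P (spread_module S) (spread_module T) :: ('p \<Rightarrow> 'k \<Rightarrow> 'k) set"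
  have \<phi>_in: "\<phi> l y = l i" if "i \<in> {1..n}" "y \<in> X i" for l i y
  proof -
    have "\<phi> l y = (\<Sum>j\<in>{1..n}. if j = i then l i else 0)"
      unfolding \<phi>_def using disjoint that by (intro sum.cong) auto
    then show ?thesis
      using that by simp
  qed
  have \<phi>_out: "\<phi> l y = 0" if "y \<notin> (\<Union>i\<in>{1..n}. X i)" for l y
    unfolding \<phi>_def using that by (intro sum.neutral) auto
  have "scalar_hom S T (\<phi> l)" for l
  proof -
    have "\<phi> l y = 0" if "y \<notin> S \<inter> T" for y
      using that X(1) component_subset by (intro \<phi>_out) blast
    moreover have "\<phi> l p = \<phi> l q" if "p \<in> S" "q \<in> T" "p \<le> q" for p q
      unfolding \<phi>_def
      using that X(1,2) star_component_iff[OF assms(1), of _ A B C D p q]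
      by (intro sum.cong) (auto simp: S_def T_def)
    ultimately show ?thesis
      unfolding scalar_hom_def by blast
  qed
  then have \<Phi>_Hom: "\<Phi> l \<in> ?H" for l
    unfolding Hom_spread_module_iff[OF SP] \<Phi>_def by (intro exI[of _ "\<phi> l"] conjI refl)
  have \<Psi>\<Phi>: "\<Psi> (\<Phi> l) = l" if "l \<in> coord_space n" for l
  proof
    show "\<Psi> (\<Phi> l) i = l i" for i
      using that \<phi>_in[OF _ X(3), of i l]
      by (cases "i \<in> {1..n}") (auto simp: \<Psi>_def \<Phi>_def coord_space_def)
  qed
  have \<Phi>\<Psi>: "\<Phi> (\<Psi> f) = f" if Hom: "f \<in> ?H" for f
  proof -
    obtain g where g: "scalar_hom S T g" and f: "f = (\<lambda>y v. g y * v)"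
      using Hom unfolding Hom_spread_module_iff[OF SP] by blast
    have "\<phi> (\<Psi> f) y = g y" for y
    proof (cases "y \<in> (\<Union>i\<in>{1..n}. X i)")
      case True
      then obtain i where i: "i \<in> {1..n}" "y \<in> X i"
        by blast
      then show ?thesis
        using scalar_hom_constant_on_component[OF g X(1)[OF i(1)] i(2) X(3)[OF i(1)]]
        by (simp add: \<phi>_in[OF i] \<Psi>_def f)
    next
      case False
      have "g y = 0"
      proof (cases "y \<in> S \<inter> T")
        case True
        then obtain Z where Z: "Z \<in> components_in P (S \<inter> T)" "y \<in> Z"
          using equiv_path_connected_in[of "S \<inter> T" P] unfolding components_in_def
          by (metis UnionE Union_quotient)
        then have "\<not> star_condition A D Z"
          using False assms(4) unfolding S_def T_def bij_betw_def by blast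
        then show ?thesis
          using scalar_hom_vanishes[OF assms(1-3)] g Z unfolding S_def T_def by blast
      next
        case False
        then show ?thesis
          using g unfolding scalar_hom_def by blast
      qed
      then show ?thesis
        using \<phi>_out[OF False] by simp
    qed
    then show ?thesis
      by (simp add: \<Phi>_def f)
  qed
  have \<phi>_add: "\<phi> (l + m) y = \<phi> l y + \<phi> m y" for l m y
    unfolding \<phi>_def sum.distrib[symmetric] by (intro sum.cong) auto
  have \<phi>_scale: "\<phi> (coord_scale c l) y = c * \<phi> l y" for c l y
    unfolding \<phi>_def sum_distrib_left by (intro sum.cong) (auto simp: coord_scale_def)
  have \<Phi>_linear: "\<Phi> (l + m) = \<Phi> l + \<Phi> m"
    "\<Phi> (coord_scale c l) = hom_scale (spread_module T) c (\<Phi> l)" for l m c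
    by (simp_all add: \<Phi>_def \<phi>_add \<phi>_scale fun_eq_iff hom_scale_def spread_module_def distrib_right
        mult.assoc)
  have "linear_on coord_scale (coord_space n) (hom_scale (spread_module T)) ?H \<Phi>"
    unfolding linear_on_def by (intro conjI ballI allI \<Phi>_Hom \<Phi>_linear)
  moreover have "linear_on (hom_scale (spread_module T)) ?H coord_scale (coord_space n) \<Psi>"
    unfolding linear_on_def
    by (intro conjI ballI allI)
      (simp_all add: \<Psi>_def coord_space_def coord_scale_def hom_scale_def spread_module_def fun_eq_iff)
  ultimately have "inverse_isomorphisms coord_scale (coord_space n)
      (hom_scale (spread_module T)) ?H \<Phi> \<Psi>"
    using \<Psi>\<Phi> \<Phi>\<Psi> unfolding inverse_isomorphisms_def by (intro conjI ballI)
  moreover have "\<Phi> l y = (\<lambda>v. l i * v)" if "i \<in> {1..n}" "y \<in> X i" for l i y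
    using \<phi>_in[OF that] by (simp add: \<Phi>_def)
  moreover have "\<Phi> l y = (\<lambda>v. 0)" if "y \<notin> (\<Union>i\<in>{1..n}. X i)" for l y
    using \<phi>_out[OF that] by (simp add: \<Phi>_def fun_eq_iff)
  ultimately show ?thesis
    unfolding S_def T_def
    by (intro exI[of _ \<Phi>] exI[of _ \<Psi>] conjI ballI allI impI) (auto simp: \<Psi>_def)
qed

end
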